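(* Let $d\ge1$, let $\mu_1,\mu_2\in\mathbb{R}^d$ and let $\Sigma_1,\Sigma_2$ be real symmetric positive-definite $d\times d$ matrices. For $i\in\{1,2\}$ let $\bar P_i=f(\mu_i,\Sigma_i)$, where $$f(\mu,\Sigma)=\begin{bmatrix}\Sigma+\mu\mu^\top&\mu\\ \mu^\top&1\end{bmatrix},$$ a symmetric positive-definite $(d+1)\times(d+1)$ matrix, and let $q_{\bar P_i}=p_{0,\bar P_i}$ be the density of the centered $(d+1)$-variate normal distribution with covariance matrix $\bar P_i$. Then $$D_{\mathrm{KL}}[p_{\mu_1,\Sigma_1}:p_{\mu_2,\Sigma_2}]=D_{\mathrm{KL}}[q_{\bar P_1}:q_{\bar P_2}].$$
   Context: For $\mu\in\mathbb{R}^k$ and $\Sigma$ symmetric positive-definite of size $k\times k$, $p_{\mu,\Sigma}$ denotes the probability density on $\mathbb{R}^k$ of the $k$-variate normal distribution with mean $\mu$ and covariance matrix $\Sigma$. The Kullback-Leibler divergence between densities on $\mathbb{R}^k$ is $D_{\mathrm{KL}}[p:q]=\int_{\mathbb{R}^k}p(x)\log\frac{p(x)}{q(x)}\,dx$. *)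

theory Defs
  imports "HOL-Analysis.Analysis"
begin

definition sym_posdef :: "real^'n^'n \<Rightarrow> bool" where
  "sym_posdef A \<longleftrightarrow> transpose A = A \<and> (\<forall>x. x \<noteq> 0 \<longrightarrow> 0 < x \<bullet> (A *v x))"

text \<open>Meaningful only for symmetric positive-definite \<open>\<Sigma>\<close>.\<close>

definition mvn_density :: "real^'n \<Rightarrow> real^'n^'n \<Rightarrow> real^'n \<Rightarrow> real" where
  "mvn_density \<mu> \<Sigma> x =
     exp (- ((x - \<mu>) \<bullet> (matrix_inv \<Sigma> *v (x - \<mu>))) / 2) / sqrt ((2 * pi) ^ CARD('n) * det \<Sigma>)"

text \<open>The arguments are densities with respect to Lebesgue measure. The Bochner integral is \<open>0\<close>
  when the integrand is not integrable; for two nondegenerate normal densities it is integrable.\<close>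

definition KL_div :: "('a::euclidean_space \<Rightarrow> real) \<Rightarrow> ('a \<Rightarrow> real) \<Rightarrow> real" where
  "KL_div p q = (LINT x|lborel. p x * ln (p x / q x))"

text \<open>The index type \<open>'n option\<close> has one element more than \<open>'n\<close>: \<open>Some i\<close> are the old
  coordinates, \<open>None\<close> is the last row and column of the block matrix
  \<open>[[\<Sigma> + \<mu> \<mu>\<^sup>T, \<mu>], [\<mu>\<^sup>T, 1]]\<close>.\<close>

definition gauss_embed :: "real^'n \<Rightarrow> real^'n^'n \<Rightarrow> real^('n option)^('n option)" where
  "gauss_embed \<mu> \<Sigma> = (\<chi> i j.
     case i of
       Some a \<Rightarrow> (case j of Some b \<Rightarrow> \<Sigma> $ a $ b + \<mu> $ a * \<mu> $ b | None \<Rightarrow> \<mu> $ a)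
     | None \<Rightarrow> (case j of Some b \<Rightarrow> \<mu> $ b | None \<Rightarrow> 1))"

end

theory Submission
  imports Defs "HOL-Probability.Distributions"
begin

text \<open>Write a point of \<open>\<real>\<^sup>d\<^sup>+\<^sup>1\<close> as \<open>(x, t)\<close>. Inverting the block matrix gives
  \<open>q\<^sub>P(x, t) = \<phi>(t) p\<^sub>t\<^sub>\<mu>\<^sub>,\<^sub>\<Sigma>(x)\<close>, where \<open>\<phi>\<close> is the standard normal density on the line, so by Fubini the
  divergence of the embedded densities is the \<open>\<phi>\<close>-average over \<open>t\<close> of the divergence of the densities
  with means \<open>t\<mu>\<^sub>1\<close> and \<open>t\<mu>\<^sub>2\<close>. That divergence has the form \<open>K + t\<^sup>2 D\<close>: translating by \<open>t\<mu>\<^sub>1\<close> leaves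
  a term linear in \<open>t\<close>, which is an odd function of \<open>x\<close> and integrates to \<open>0\<close>. As \<open>\<phi>\<close> has total mass
  and second moment \<open>1\<close>, the average is \<open>K + D\<close>, the value at \<open>t = 1\<close>. Neither a closed form for the
  divergence nor the normalization of the multivariate density is needed.\<close>

section \<open>Symmetric positive-definite matrices and bounds on quadratic forms\<close>

lemma sym_inner_matrix:
  fixes A :: "real^'n^'n"
  assumes "transpose A = A"
  shows "(A *v x) \<bullet> y = x \<bullet> (A *v y)"
  by (metis assms dot_lmul_matrix vector_transpose_matrix)

lemma sym_posdef_invertible:
  assumes "sym_posdef A"
  shows "invertible A"
proof -
  have "x = 0" if "A *v x = 0" for x
    using assms that unfolding sym_posdef_def by (metis inner_zero_right less_irrefl)
  then show ?thesis
    using matrix_left_invertible_ker invertible_left_inverse by blast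
qed

lemma matrix_inv_mult_vector:
  fixes A :: "real^'n^'n"
  assumes "invertible A"
  shows "A *v (matrix_inv A *v x) = x" "matrix_inv A *v (A *v x) = x"
proof -
  have "A ** matrix_inv A = mat 1 \<and> matrix_inv A ** A = mat 1"
    using assms unfolding invertible_def matrix_inv_def by (rule someI_ex)
  then show "A *v (matrix_inv A *v x) = x" "matrix_inv A *v (A *v x) = x"
    by (simp_all add: matrix_vector_mul_assoc)
qed

text \<open>With \<open>B\<close> the inverse and y = Bx, symmetry of \<open>A\<close> gives x
  \<bullet> Bx = y \<bullet> Ay, and y is nonzero when x is; symmetry of \<open>B\<close> is that of
  \<open>A\<close> tested on vectors Bx, By.\<close>

lemma sym_posdef_matrix_inv:
  fixes A :: "real^'n^'n"
  assumes A: "sym_posdef A"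
  shows "sym_posdef (matrix_inv A)"
proof -
  let ?B = "matrix_inv A"
  note inv = matrix_inv_mult_vector[OF sym_posdef_invertible[OF A]]
  have sym: "x \<bullet> (?B *v y) = (?B *v x) \<bullet> y" for x y
    using sym_inner_matrix[of A "?B *v x" "?B *v y"] A by (simp add: sym_posdef_def inv)
  have "(transpose ?B) *v y = ?B *v y" for y
  proof -
    have "x \<bullet> (transpose ?B *v y) = x \<bullet> (?B *v y)" for x
      by (metis sym dot_lmul_matrix vector_transpose_matrix transpose_transpose)
    then show ?thesis by (metis vector_eq_rdot inner_commute)
  qed
  then have "transpose ?B = ?B" by (simp add: matrix_eq)
  moreover have "0 < x \<bullet> (?B *v x)" if "x \<noteq> 0" for x
  proof -
    have "?B *v x \<noteq> 0" using that inv(1)[of x] by auto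
    then have "0 < (?B *v x) \<bullet> (A *v (?B *v x))" using A by (simp add: sym_posdef_def)
    then show ?thesis by (simp add: inv inner_commute)
  qed
  ultimately show ?thesis by (simp add: sym_posdef_def)
qed

text \<open>The constant is the minimum of the form on the unit sphere: compactness makes it
  attained, definiteness makes it positive, and homogeneity extends the bound to all
  vectors.\<close>

lemma sym_posdef_lower_bound:
  fixes A :: "real^'n^'n"
  assumes A: "sym_posdef A"
  obtains c where "0 < c" "\<And>x. c * (x \<bullet> x) \<le> x \<bullet> (A *v x)"
proof -
  have cont: "continuous_on (sphere 0 1) (\<lambda>x. x \<bullet> (A *v x))"
    by (intro continuous_intros)
  have ne: "sphere (0::real^'n) 1 \<noteq> {}" by simp
  obtain u where u: "u \<in> sphere 0 1" "\<And>x. x \<in> sphere 0 1 \<Longrightarrow> u \<bullet> (A *v u) \<le> x \<bullet> (A *v x)"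
    using continuous_attains_inf[OF compact_sphere ne cont] by blast
  have "u \<noteq> 0" using u(1) by auto
  then have pos: "0 < u \<bullet> (A *v u)" using A by (simp add: sym_posdef_def)
  have "(u \<bullet> (A *v u)) * (x \<bullet> x) \<le> x \<bullet> (A *v x)" for x
  proof (cases "x = 0")
    case False
    let ?y = "(1 / norm x) *\<^sub>R x"
    have "u \<bullet> (A *v u) \<le> ?y \<bullet> (A *v ?y)" using False by (intro u(2)) simp
    also have "\<dots> = (x \<bullet> (A *v x)) / (x \<bullet> x)"
      by (simp add: matrix_vector_mult_scaleR power2_norm_eq_inner[symmetric] power2_eq_square)
    finally show ?thesis using False by (simp add: pos_le_divide_eq)
  qed simp
  with pos show ?thesis by (rule that)
qed

lemma quadratic_form_bound:
  fixes A :: "real^'n^'n"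
  obtains K where "0 \<le> K" "\<And>x. \<bar>x \<bullet> (A *v x)\<bar> \<le> K * (x \<bullet> x)"
proof -
  have "\<bar>x \<bullet> (A *v x)\<bar> \<le> onorm ((*v) A) * (x \<bullet> x)" for x
  proof -
    have "\<bar>x \<bullet> (A *v x)\<bar> \<le> norm x * norm (A *v x)" by (rule Cauchy_Schwarz_ineq2)
    also have "\<dots> \<le> norm x * (onorm ((*v) A) * norm x)"
      by (intro mult_left_mono onorm matrix_vector_mul_bounded_linear norm_ge_zero)
    also have "\<dots> = onorm ((*v) A) * (x \<bullet> x)"
      by (simp add: power2_norm_eq_inner[symmetric] power2_eq_square)
    finally show ?thesis .
  qed
  then show ?thesis using onorm_pos_le[OF matrix_vector_mul_bounded_linear[of A]] that by blast
qed

section \<open>Integrability against a normal density\<close>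

text \<open>The integrand is a product of one-dimensional Gaussians over the basis coordinates, so
  Tonelli turns the integral into a power of a finite one.\<close>

lemma integrable_exp_neg_norm_sq:
  assumes "0 < c"
  shows "integrable lborel (\<lambda>x::'a::euclidean_space. exp (- c * (x \<bullet> x)))"
proof (rule integrableI_nonneg)
  let ?g = "\<lambda>t::real. exp (- c * t\<^sup>2)"
  \<comment> \<open>Chosen so that 1 / (2 \<sigma>^2) = c, which makes \<open>?g\<close> a multiple
    of a normal density.\<close>
  define \<sigma> where "\<sigma> = 1 / sqrt (2 * c)"
  have \<sigma>: "\<sigma> > 0" using assms by (simp add: \<sigma>_def)
  have "?g t = sqrt (2 * pi * \<sigma>\<^sup>2) * normal_density 0 \<sigma> t" for t
    using assms \<sigma> by (simp add: normal_density_def \<sigma>_def power_divide)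
  then have "integrable lborel ?g"
    using integrable_normal_density[OF \<sigma>, of 0] by simp
  then have fin: "(\<integral>\<^sup>+t. ?g t \<partial>lborel) < \<infinity>"
    by (simp add: integrable_iff_bounded)
  have "(\<integral>\<^sup>+x. exp (- c * (x \<bullet> x)) \<partial>(lborel::'a measure)) =
      (\<integral>\<^sup>+x. (\<Prod>b\<in>Basis. ennreal (?g (x \<bullet> b))) \<partial>(lborel::'a measure))"
  proof (rule nn_integral_cong)
    fix x :: 'a
    have "x \<bullet> x = (\<Sum>b\<in>Basis. (x \<bullet> b)\<^sup>2)"
      by (subst euclidean_inner) (simp add: power2_eq_square)
    then have "exp (- c * (x \<bullet> x)) = (\<Prod>b\<in>Basis. ?g (x \<bullet> b))"
      by (simp only: sum_distrib_left exp_sum[OF finite_Basis])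
    then show "ennreal (exp (- c * (x \<bullet> x))) = (\<Prod>b\<in>Basis. ennreal (?g (x \<bullet> b)))"
      by (simp add: prod_ennreal)
  qed
  also have "\<dots> = (\<Prod>b\<in>(Basis::'a set). (\<integral>\<^sup>+t. ?g t \<partial>lborel))"
    by (rule nn_integral_lborel_prod) auto
  also have "\<dots> < \<infinity>" using fin by (simp add: power_less_top_ennreal)
  finally show "(\<integral>\<^sup>+x. exp (- c * (x \<bullet> x)) \<partial>(lborel::'a measure)) < \<infinity>" .
qed auto

lemma borel_measurable_mvn_density [measurable]: "mvn_density \<mu> \<Sigma> \<in> borel_measurable borel"
proof -
  have "continuous_on UNIV (\<lambda>x. exp (- ((x - \<mu>) \<bullet> (matrix_inv \<Sigma> *v (x - \<mu>))) / 2))"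
    by (intro continuous_intros continuous_on_compose2[OF matrix_vector_mult_linear_continuous_on]) auto
  then show ?thesis unfolding mvn_density_def[abs_def]
    by (intro borel_measurable_divide borel_measurable_continuous_onI) auto
qed

text \<open>Gaussian decay dominates quadratic growth. This yields integrability of the density
  itself, of its product with a linear form, and of the divergence integrand.\<close>

lemma integrable_mvn_density_mult:
  fixes f :: "real^'n \<Rightarrow> real"
  assumes S: "sym_posdef \<Sigma>" and [measurable]: "f \<in> borel_measurable borel"
    and K: "\<And>x. \<bar>f x\<bar> \<le> K * (1 + x \<bullet> x)"
  shows "integrable lborel (\<lambda>x. mvn_density 0 \<Sigma> x * f x)"
proof -
  obtain c where c: "0 < c" "\<And>x. c * (x \<bullet> x) \<le> x \<bullet> (matrix_inv \<Sigma> *v x)"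
    using sym_posdef_lower_bound[OF sym_posdef_matrix_inv[OF S]] by blast
  define N where "N = \<bar>1 / sqrt ((2 * pi) ^ CARD('n) * det \<Sigma>)\<bar>"
  have K0: "0 \<le> K" using K[of 0] by (smt (verit) inner_zero_left mult_cancel_left1)
  \<comment> \<open>The density decays at least at rate c/2; half of that rate is spent on absorbing
    the growth of \<open>f\<close>, leaving c/4.\<close>
  let ?g = "\<lambda>x::real^'n. N * (K * (1 + 4 / c)) * exp (- (c / 4) * (x \<bullet> x))"
  have "integrable lborel ?g"
    using c(1) by (intro integrable_mult_right integrable_exp_neg_norm_sq) simp
  then show ?thesis
  proof (rule Bochner_Integration.integrable_bound)
    show "AE x in lborel. norm (mvn_density 0 \<Sigma> x * f x) \<le> norm (?g x)"
    proof (rule AE_I2)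
      fix x :: "real^'n"
      let ?u = "x \<bullet> x"
      \<comment> \<open>The right side expands to 1 + u plus nonnegative terms, since (4/c)(c/4) =
        1.\<close>
      have "1 + ?u \<le> (1 + 4 / c) * (1 + (c / 4) * ?u)"
        using c(1) by (simp add: field_simps)
      also have "\<dots> \<le> (1 + 4 / c) * exp ((c / 4) * ?u)"
        using c(1) by (intro mult_left_mono exp_ge_add_one_self) auto
      finally have 1: "1 + ?u \<le> (1 + 4 / c) * exp ((c / 4) * ?u)" .
      have 2: "exp (- (x \<bullet> (matrix_inv \<Sigma> *v x)) / 2) \<le> exp (- (c / 2) * ?u)"
        using c(2)[of x] by simp
      have "\<bar>mvn_density 0 \<Sigma> x * f x\<bar> = N * (exp (- (x \<bullet> (matrix_inv \<Sigma> *v x)) / 2) * \<bar>f x\<bar>)"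
        by (simp add: mvn_density_def abs_mult N_def)
      also have "\<dots> \<le> N * (exp (- (c / 2) * ?u) * (K * ((1 + 4 / c) * exp ((c / 4) * ?u))))"
        using 1 2 K0 K[of x]
        by (intro mult_left_mono mult_mono order_trans[OF K[of x]]) (auto simp: N_def)
      also have "\<dots> = ?g x"
        by (simp add: exp_add[symmetric] mult.assoc mult.left_commute algebra_simps)
      finally show "norm (mvn_density 0 \<Sigma> x * f x) \<le> norm (?g x)" by simp
    qed
  qed simp
qed

section \<open>The log-ratio of two normal densities\<close>

lemma mvn_density_translate: "mvn_density \<mu> \<Sigma> x = mvn_density 0 \<Sigma> (x - \<mu>)"
  by (simp add: mvn_density_def)

text \<open>Nonvanishing determinants suffice here: in Isabelle, \<open>ln x = ln \<bar>x\<bar>\<close>, and \<open>sqrt\<close> is odd.\<close>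

lemma ln_mvn_density_ratio:
  fixes \<Sigma>1 \<Sigma>2 :: "real^'n^'n"
  assumes "det \<Sigma>1 \<noteq> 0" "det \<Sigma>2 \<noteq> 0"
  shows "ln (mvn_density \<mu>1 \<Sigma>1 x / mvn_density \<mu>2 \<Sigma>2 x) =
    ln (sqrt ((2 * pi) ^ CARD('n) * det \<Sigma>2)) - ln (sqrt ((2 * pi) ^ CARD('n) * det \<Sigma>1))
    + ((x - \<mu>2) \<bullet> (matrix_inv \<Sigma>2 *v (x - \<mu>2))) / 2
    - ((x - \<mu>1) \<bullet> (matrix_inv \<Sigma>1 *v (x - \<mu>1))) / 2"
  using assms by (simp add: mvn_density_def ln_div ln_mult)

text \<open>The log-ratio is a constant plus quadratic forms in x, so it grows at most
  quadratically.\<close>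

lemma integrable_KL_integrand_centered:
  fixes \<Sigma>1 \<Sigma>2 :: "real^'n^'n"
  assumes S: "sym_posdef \<Sigma>1" "sym_posdef \<Sigma>2"
  shows "integrable lborel
    (\<lambda>x. mvn_density 0 \<Sigma>1 x * ln (mvn_density 0 \<Sigma>1 x / mvn_density 0 \<Sigma>2 x))"
proof -
  have det: "det \<Sigma>1 \<noteq> 0" "det \<Sigma>2 \<noteq> 0"
    using S sym_posdef_invertible invertible_det_nz by blast+
  obtain K1 where K1: "0 \<le> K1" "\<And>x. \<bar>x \<bullet> (matrix_inv \<Sigma>1 *v x)\<bar> \<le> K1 * (x \<bullet> x)"
    using quadratic_form_bound by blast
  obtain K2 where K2: "0 \<le> K2" "\<And>x. \<bar>x \<bullet> (matrix_inv \<Sigma>2 *v x)\<bar> \<le> K2 * (x \<bullet> x)"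
    using quadratic_form_bound by blast
  let ?C = "ln (sqrt ((2 * pi) ^ CARD('n) * det \<Sigma>2)) - ln (sqrt ((2 * pi) ^ CARD('n) * det \<Sigma>1))"
  show ?thesis
  proof (rule integrable_mvn_density_mult[OF S(1), where K = "\<bar>?C\<bar> + K1 + K2"])
    fix x :: "real^'n"
    have "\<bar>ln (mvn_density 0 \<Sigma>1 x / mvn_density 0 \<Sigma>2 x)\<bar> \<le> \<bar>?C\<bar> + K1 * (x \<bullet> x) + K2 * (x \<bullet> x)"
      using K1(2)[of x] K2(2)[of x] by (simp add: ln_mvn_density_ratio[OF det])
    also have "\<dots> \<le> (\<bar>?C\<bar> + K1 + K2) * (1 + x \<bullet> x)"
      using K1(1) K2(1) by (simp add: algebra_simps)
    finally show "\<bar>ln (mvn_density 0 \<Sigma>1 x / mvn_density 0 \<Sigma>2 x)\<bar> \<le> (\<bar>?C\<bar> + K1 + K2) * (1 + x \<bullet> x)" .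
  qed measurable
qed

section \<open>Dependence of the divergence on the means\<close>

text \<open>Reflection is the affine map with factor -1, whose Jacobian has modulus 1; it preserves
  Lebesgue measure, so the integral equals its own negative.\<close>

lemma lborel_integral_odd:
  fixes f :: "'a::euclidean_space \<Rightarrow> real"
  assumes [measurable]: "f \<in> borel_measurable borel" and "\<And>x. f (- x) = - f x"
  shows "(LINT x|lborel. f x) = 0"
proof -
  have "(lborel::'a measure) = density (distr lborel borel (\<lambda>x. 0 + (-1) *\<^sub>R x)) (\<lambda>_. ennreal (\<bar>-1\<bar> ^ DIM('a)))"
    by (rule lborel_affine) simp
  also have "\<dots> = distr lborel borel uminus" by (simp add: density_1)
  finally have "(LINT x|lborel. f x) = (LINT x|distr lborel borel uminus. f x)" by (rule arg_cong)
  also have "\<dots> = (LINT x|lborel. f (- x))"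
    by (rule integral_distr) auto
  finally show ?thesis by (simp add: assms(2))
qed

lemma lborel_integral_shift:
  fixes f :: "'a::euclidean_space \<Rightarrow> real"
  assumes [measurable]: "f \<in> borel_measurable borel"
  shows "(LINT x|lborel. f x) = (LINT x|lborel. f (c + x))"
  by (subst lborel_distr_plus[of c, symmetric], rule integral_distr) auto

text \<open>Substitute x = \<mu>1 + y and expand the quadratic form of the second density: its pure
  part gives the centered divergence, its cross term is odd in y, and its constant term multiplies
  the total mass.\<close>

lemma KL_div_mvn_translate:
  fixes \<Sigma>1 \<Sigma>2 :: "real^'n^'n"
  assumes S: "sym_posdef \<Sigma>1" "sym_posdef \<Sigma>2"
  shows "KL_div (mvn_density \<mu>1 \<Sigma>1) (mvn_density \<mu>2 \<Sigma>2) =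
    KL_div (mvn_density 0 \<Sigma>1) (mvn_density 0 \<Sigma>2)
    + ((\<mu>1 - \<mu>2) \<bullet> (matrix_inv \<Sigma>2 *v (\<mu>1 - \<mu>2))) / 2 * (LINT x|lborel. mvn_density 0 \<Sigma>1 x)"
proof -
  have det: "det \<Sigma>1 \<noteq> 0" "det \<Sigma>2 \<noteq> 0"
    using S sym_posdef_invertible invertible_det_nz by blast+
  let ?q = "mvn_density 0 \<Sigma>1" and ?B = "matrix_inv \<Sigma>2"
  define \<delta> where "\<delta> = \<mu>1 - \<mu>2"
  let ?k = "\<lambda>x. ?q x * ln (?q x / mvn_density 0 \<Sigma>2 x)"
  let ?l = "\<lambda>x. ?q x * (x \<bullet> (?B *v \<delta>))"
  have sym: "\<delta> \<bullet> (?B *v x) = x \<bullet> (?B *v \<delta>)" for x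
    using sym_inner_matrix[of ?B x \<delta>] sym_posdef_matrix_inv[OF S(2)]
    by (simp add: sym_posdef_def inner_commute)
  have ik: "integrable lborel ?k" by (rule integrable_KL_integrand_centered[OF S])
  have il: "integrable lborel ?l"
  proof (rule integrable_mvn_density_mult[OF S(1), where K = "norm (?B *v \<delta>)"])
    fix x :: "real^'n"
    have "norm x \<le> 1 + x \<bullet> x"
      unfolding power2_norm_eq_inner[symmetric]
      \<comment> \<open>The square gives 2 |x| \<le> 1 + |x|^2, and |x| \<le> 2 |x|.\<close>
      using zero_le_power2[of "norm x - 1"] by (simp add: power2_diff) (smt (verit) norm_ge_zero)
    then have "norm x * norm (?B *v \<delta>) \<le> (1 + x \<bullet> x) * norm (?B *v \<delta>)"
      by (rule mult_right_mono) simp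
    then show "\<bar>x \<bullet> (?B *v \<delta>)\<bar> \<le> norm (?B *v \<delta>) * (1 + x \<bullet> x)"
      using Cauchy_Schwarz_ineq2[of x "?B *v \<delta>"] by (simp add: mult.commute)
  qed simp
  have iq: "integrable lborel ?q"
    using integrable_mvn_density_mult[OF S(1), of "\<lambda>_. 1" 1] by simp
  have l0: "(LINT x|lborel. ?l x) = 0"
  proof (rule lborel_integral_odd)
    show "?l (- x) = - ?l x" for x
      by (simp add: mvn_density_def linear_neg[OF matrix_vector_mul_linear])
  qed simp
  have "KL_div (mvn_density \<mu>1 \<Sigma>1) (mvn_density \<mu>2 \<Sigma>2) =
    (LINT y|lborel. mvn_density \<mu>1 \<Sigma>1 (\<mu>1 + y) *
       ln (mvn_density \<mu>1 \<Sigma>1 (\<mu>1 + y) / mvn_density \<mu>2 \<Sigma>2 (\<mu>1 + y)))"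
    unfolding KL_div_def by (rule lborel_integral_shift) simp
  also have "\<dots> = (LINT y|lborel. ?k y + ?l y + (\<delta> \<bullet> (?B *v \<delta>)) / 2 * ?q y)"
  proof (rule Bochner_Integration.integral_cong)
    fix y :: "real^'n"
    have "\<mu>1 + y - \<mu>2 = y + \<delta>" by (simp add: \<delta>_def)
    \<comment> \<open>Symmetry of \<open>?B\<close> merges the two cross terms; the factor 2 cancels
      the 1/2 of the exponent and leaves \<open>?l\<close>.\<close>
    then have quad: "((\<mu>1 + y - \<mu>2) \<bullet> (?B *v (\<mu>1 + y - \<mu>2))) =
        y \<bullet> (?B *v y) + 2 * (y \<bullet> (?B *v \<delta>)) + \<delta> \<bullet> (?B *v \<delta>)"
      by (simp only:) (simp add: matrix_vector_right_distrib inner_add_left inner_add_right sym[of y])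
    show "mvn_density \<mu>1 \<Sigma>1 (\<mu>1 + y) *
       ln (mvn_density \<mu>1 \<Sigma>1 (\<mu>1 + y) / mvn_density \<mu>2 \<Sigma>2 (\<mu>1 + y)) =
       ?k y + ?l y + (\<delta> \<bullet> (?B *v \<delta>)) / 2 * ?q y"
      unfolding ln_mvn_density_ratio[OF det] quad
      by (simp add: mvn_density_translate[of \<mu>1 _ "\<mu>1 + y"] algebra_simps add_divide_distrib)
  qed simp
  also have "\<dots> = (LINT y|lborel. ?k y) + (LINT y|lborel. ?l y) + (\<delta> \<bullet> (?B *v \<delta>)) / 2 * (LINT y|lborel. ?q y)"
    using ik il iq by simp
  finally show ?thesis by (simp add: l0 KL_div_def flip: \<delta>_def)
qed

section \<open>Block coordinates, positivity and inverse of the embedded matrix\<close>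

definition join_coord :: "real^'n \<Rightarrow> real \<Rightarrow> real^('n option)" where
  "join_coord x t = (\<chi> i. case i of Some a \<Rightarrow> x $ a | None \<Rightarrow> t)"

lemma join_coord_nth [simp]:
  "join_coord x t $ Some a = x $ a" "join_coord x t $ None = t"
  by (simp_all add: join_coord_def)

lemma join_coord_cases:
  obtains x t where "z = join_coord x t"
proof
  show "z = join_coord (\<chi> a. z $ Some a) (z $ None)"
    by (simp add: join_coord_def vec_eq_iff split: option.split)
qed

lemma join_coord_eq_0_iff: "join_coord x t = 0 \<longleftrightarrow> x = 0 \<and> t = 0"
  by (auto simp: vec_eq_iff split_option_all)

lemma sum_UNIV_option:
  fixes f :: "'n::finite option \<Rightarrow> 'b::comm_monoid_add"
  shows "sum f UNIV = f None + (\<Sum>a\<in>UNIV. f (Some a))"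
  by (simp add: UNIV_option_conv sum.reindex)

lemma prod_UNIV_option:
  fixes f :: "'n::finite option \<Rightarrow> 'b::comm_monoid_mult"
  shows "prod f UNIV = f None * (\<Prod>a\<in>UNIV. f (Some a))"
  by (simp add: UNIV_option_conv prod.reindex)

lemma inner_join_coord [simp]: "join_coord x t \<bullet> join_coord y s = x \<bullet> y + t * s"
  by (simp add: inner_vec_def sum_UNIV_option)

text \<open>Both positivity and the inverse of the block matrix are read off from this
  product.\<close>

lemma gauss_embed_mult_join_coord:
  "gauss_embed \<mu> \<Sigma> *v join_coord x t =
    join_coord (\<Sigma> *v x + (\<mu> \<bullet> x + t) *\<^sub>R \<mu>) (\<mu> \<bullet> x + t)"
  by (simp add: vec_eq_iff split_option_all gauss_embed_def matrix_vector_mult_def sum_UNIV_option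
      inner_vec_def sum.distrib sum_distrib_left algebra_simps)

text \<open>The form at (x, t) is x \<bullet> \<Sigma>x + (\<mu> \<bullet> x + t)^2. The first term
  is positive unless x = 0, and then the second is t^2 with t nonzero.\<close>

lemma sym_posdef_gauss_embed:
  assumes S: "sym_posdef \<Sigma>"
  shows "sym_posdef (gauss_embed \<mu> \<Sigma>)"
proof -
  have "\<Sigma> $ a $ b = \<Sigma> $ b $ a" for a b
  proof -
    have "transpose \<Sigma> $ a $ b = \<Sigma> $ a $ b" using S by (simp add: sym_posdef_def)
    then show ?thesis by (simp add: transpose_def)
  qed
  then have "transpose (gauss_embed \<mu> \<Sigma>) = gauss_embed \<mu> \<Sigma>"
    by (simp add: vec_eq_iff split_option_all gauss_embed_def transpose_def mult.commute)
  moreover have "0 < z \<bullet> (gauss_embed \<mu> \<Sigma> *v z)" if "z \<noteq> 0" for z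
  proof -
    obtain x t where z: "z = join_coord x t" by (rule join_coord_cases)
    have eq: "z \<bullet> (gauss_embed \<mu> \<Sigma> *v z) = x \<bullet> (\<Sigma> *v x) + (\<mu> \<bullet> x + t)\<^sup>2"
      by (simp add: z gauss_embed_mult_join_coord inner_add_right inner_commute power2_eq_square algebra_simps)
    show ?thesis
    proof (cases "x = 0")
      case True
      then show ?thesis using that by (simp add: eq) (simp add: z join_coord_eq_0_iff)
    next
      case False
      then show ?thesis using S by (simp add: eq sym_posdef_def add_pos_nonneg)
    qed
  qed
  ultimately show ?thesis by (simp add: sym_posdef_def)
qed

lemma gauss_embed_inv_quadratic_form:
  assumes S: "sym_posdef \<Sigma>"
  shows "join_coord x t \<bullet> (matrix_inv (gauss_embed \<mu> \<Sigma>) *v join_coord x t) =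
    (x - t *\<^sub>R \<mu>) \<bullet> (matrix_inv \<Sigma> *v (x - t *\<^sub>R \<mu>)) + t\<^sup>2"
proof -
  let ?w = "matrix_inv \<Sigma> *v (x - t *\<^sub>R \<mu>)"
  \<comment> \<open>The preimage of (x, t) is found by solving the block system: the last row forces
    \<mu> \<bullet> w + s = t, and the other rows then read \<Sigma>w + t\<mu> = x.\<close>
  have "gauss_embed \<mu> \<Sigma> *v join_coord ?w (t - \<mu> \<bullet> ?w) = join_coord x t"
    by (simp add: gauss_embed_mult_join_coord matrix_inv_mult_vector[OF sym_posdef_invertible[OF S]])
  then have "matrix_inv (gauss_embed \<mu> \<Sigma>) *v join_coord x t = join_coord ?w (t - \<mu> \<bullet> ?w)"
    by (metis matrix_inv_mult_vector(2) sym_posdef_invertible sym_posdef_gauss_embed[OF S])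
  then show ?thesis
    by (simp add: inner_diff_left power2_eq_square algebra_simps)
qed

section \<open>The determinant of the embedded matrix\<close>

lemma det_add_row_multiples:
  fixes A :: "'a::comm_ring_1^'n^'n"
  assumes "finite T" "k \<notin> T"
  shows "det (\<chi> i. if i \<in> T then row i A + c i *s row k A else row i A) = det A"
  using assms
proof (induction T)
  case empty
  then show ?case by (simp add: row_def vec_lambda_eta)
next
  case (insert j T)
  let ?B = "(\<chi> i. if i \<in> T then row i A + c i *s row k A else row i A) :: 'a^'n^'n"
  \<comment> \<open>Neither \<open>j\<close> nor \<open>k\<close> lies in \<open>T\<close>, so both
    rows of \<open>?B\<close> are still those of \<open>A\<close> and one elementary row operation
    remains.\<close>
  have eq: "(\<chi> i. if i \<in> insert j T then row i A + c i *s row k A else row i A) =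
    (\<chi> i. if i = j then row j ?B + c j *s row k ?B else row i ?B)"
    using insert by (auto simp: vec_eq_iff row_def)
  have "det (\<chi> i. if i = j then row j ?B + c j *s row k ?B else row i ?B) = det ?B"
    using insert.prems by (intro det_row_operation) auto
  then show ?case
    unfolding eq using insert.IH insert.prems by simp
qed

text \<open>In the Leibniz sum only permutations fixing \<open>None\<close> survive; conjugating by
  \<open>Some\<close> matches them with the permutations of \<open>'n\<close>, preserving
  signs.\<close>

lemma det_block_lower_triangular:
  fixes A :: "'a::comm_ring_1^'n^'n"
  shows "det (\<chi> i j. case i of
       Some a \<Rightarrow> (case j of Some b \<Rightarrow> A $ a $ b | None \<Rightarrow> 0)
     | None \<Rightarrow> (case j of Some b \<Rightarrow> v $ b | None \<Rightarrow> 1)) = det A"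
    (is "det ?M = _")
proof -
  let ?L = "map_permutation UNIV (Some :: 'n \<Rightarrow> 'n option)"
  let ?R = "map_permutation (range Some) (the :: 'n option \<Rightarrow> 'n)"
  define t where "t p = of_int (sign p) * (\<Prod>i\<in>UNIV. ?M $ i $ p i)" for p
  have bij_Some: "bij_betw Some (UNIV :: 'n set) (range Some)"
    by (simp add: bij_betw_def)
  have bij_the: "bij_betw the (range Some) (UNIV :: 'n set)"
    by (rule bij_betwI[where g = Some]) auto
  have L_Some: "?L p (Some a) = Some (p a)" for p a
    by (rule map_permutation_apply) auto
  have L_None: "?L p None = None" for p
    by (auto simp: map_permutation_def restrict_id_def)
  \<comment> \<open>Such a permutation moves \<open>None\<close>, so some row \<open>Some a\<close>
    is sent to column \<open>None\<close>, where the entry is 0.\<close>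
  have zero: "t p = 0" if perm: "p permutes UNIV" and "\<not> p permutes range Some" for p
  proof -
    have "p None \<noteq> None"
    proof
      assume "p None = None"
      then have "p permutes range Some"
        by (intro permutes_superset[OF perm]) (auto simp: UNIV_option_conv)
      then show False using that(2) by contradiction
    qed
    moreover obtain i where i: "p i = None"
      using permutes_surj[OF perm] by (metis surjD)
    ultimately obtain a where "i = Some a" by (cases i) auto
    then have "?M $ i $ p i = 0" using i by simp
    then have "(\<Prod>i\<in>UNIV. ?M $ i $ p i) = 0"
      by (intro prod_zero[OF finite_class.finite_UNIV] bexI[of _ i]) auto
    then show ?thesis unfolding t_def by (rule ssubst) simp
  qed
  have "det ?M = sum t {p. p permutes UNIV}"
    unfolding det_def t_def ..
  also have "\<dots> = sum t {p. p permutes range Some}"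
  proof (rule sum.mono_neutral_right)
    show "{p. p permutes range Some} \<subseteq> {p. p permutes (UNIV :: 'n option set)}"
      using permutes_subset by blast
  qed (use zero finite_permutations[OF finite_class.finite_UNIV] in blast)+
  also have "\<dots> = (\<Sum>p | p permutes (UNIV::'n set). of_int (sign p) * (\<Prod>a\<in>UNIV. A $ a $ p a))"
  proof (rule sum.reindex_bij_witness[of _ ?L ?R])
    fix q :: "'n option \<Rightarrow> 'n option"
    assume "q \<in> {p. p permutes range Some}"
    then have q: "q permutes range Some" by simp
    show LR: "?L (?R q) = q"
      by (rule map_permutation_compose_inv[OF bij_the q]) auto
    have R: "?R q permutes UNIV" by (rule map_permutation_permutes[OF bij_the q])
    then show "?R q \<in> {p. p permutes UNIV}" by simp
    define p where "p = ?R q"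
    have Lp: "?L p = q" unfolding p_def by (rule LR)
    have "sign q = sign p"
      unfolding Lp[symmetric] using R by (intro sign_map_permutation) (auto simp: p_def)
    moreover have "q None = None" "q (Some a) = Some (p a)" for a
      using L_None[of p] L_Some[of p a] by (simp_all only: Lp)
    \<comment> \<open>The factor split off at \<open>None\<close> is the corner entry 1.\<close>
    ultimately have "t q = of_int (sign p) * (\<Prod>a\<in>UNIV. A $ a $ p a)"
      by (simp add: t_def prod_UNIV_option)
    then show "of_int (sign (?R q)) * (\<Prod>a\<in>UNIV. A $ a $ ?R q a) = t q"
      by (simp only: p_def)
  next
    fix p :: "'n \<Rightarrow> 'n"
    assume "p \<in> {p. p permutes UNIV}"
    then have p: "p permutes UNIV" by simp
    show "?R (?L p) = p"
      by (rule map_permutation_compose_inv[OF bij_Some p]) simp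
    show "?L p \<in> {p. p permutes range Some}"
      using map_permutation_permutes[OF bij_Some p] by simp
  qed
  finally show ?thesis by (simp only: det_def)
qed

text \<open>Adding \<mu>_a times the last row (\<mu>^T, 1) to each row \<open>Some a\<close> of the
  triangular block matrix creates both \<mu>\<mu>^T and the last column \<mu>.\<close>

lemma det_gauss_embed:
  fixes \<mu> :: "real^'n"
  shows "det (gauss_embed \<mu> \<Sigma>) = det \<Sigma>"
proof -
  let ?M = "(\<chi> i j. case i of
       Some a \<Rightarrow> (case j of Some b \<Rightarrow> \<Sigma> $ a $ b | None \<Rightarrow> 0)
     | None \<Rightarrow> (case j of Some b \<Rightarrow> \<mu> $ b | None \<Rightarrow> 1)) :: real^('n option)^('n option)"
  have eq: "gauss_embed \<mu> \<Sigma> =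
    (\<chi> i. if i \<in> range Some then row i ?M + (case i of Some a \<Rightarrow> \<mu> $ a | None \<Rightarrow> 0) *s row None ?M else row i ?M)"
    by (auto simp: vec_eq_iff split_option_all gauss_embed_def row_def)
  have "det (gauss_embed \<mu> \<Sigma>) = det ?M"
    unfolding eq by (rule det_add_row_multiples) auto
  also have "\<dots> = det \<Sigma>" by (rule det_block_lower_triangular[where A = \<Sigma> and v = \<mu>])
  finally show ?thesis .
qed

section \<open>Factorization of the embedded density\<close>

text \<open>The summand t^2 of the quadratic form and the factor 2 pi of the extra dimension make up
  the standard normal density; the determinants agree.\<close>

lemma mvn_density_gauss_embed:
  fixes \<mu> :: "real^'n"
  assumes S: "sym_posdef \<Sigma>"
  shows "mvn_density 0 (gauss_embed \<mu> \<Sigma>) (join_coord x t) =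
    std_normal_density t * mvn_density (t *\<^sub>R \<mu>) \<Sigma> x"
proof -
  have "exp (- (Q + t\<^sup>2) / 2) = exp (- t\<^sup>2 / 2) * exp (- Q / 2)" for Q :: real
    by (simp add: exp_add[symmetric] field_simps)
  moreover have "sqrt ((2 * pi) ^ CARD('n option) * det \<Sigma>) =
      sqrt (2 * pi) * sqrt ((2 * pi) ^ CARD('n) * det \<Sigma>)"
    by (simp add: real_sqrt_mult)
  ultimately show ?thesis
    by (simp only: mvn_density_def std_normal_density_def det_gauss_embed diff_zero
        gauss_embed_inv_quadratic_form[OF S]) simp
qed

section \<open>Fubini in block coordinates\<close>

lemma prod_Basis_vec: "(\<Prod>b\<in>Basis. (x :: real^'n) \<bullet> b) = (\<Prod>i\<in>UNIV. x $ i)"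
proof -
  have B: "(Basis :: (real^'n) set) = range (\<lambda>i. axis i 1)"
    by (auto simp: Basis_vec_def)
  have inj: "inj (\<lambda>i::'n. axis i (1::real))"
    by (auto simp: inj_on_def axis_eq_axis)
  show ?thesis
    unfolding B by (simp add: prod.reindex[OF inj] inner_axis)
qed

lemma continuous_on_join_coord:
  "continuous_on UNIV (\<lambda>(x :: real^'n, t). join_coord x t)"
  unfolding join_coord_def case_prod_beta
proof (rule continuous_on_vec_lambda)
  fix i :: "'n option"
  show "continuous_on UNIV (\<lambda>p :: (real^'n) \<times> real. case i of None \<Rightarrow> snd p | Some a \<Rightarrow> fst p $ a)"
    by (cases i) (auto intro!: continuous_intros)
qed

text \<open>Lebesgue measure is determined by its values on boxes, and the preimage of a box is a
  product of two boxes with the same total volume.\<close>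

lemma lborel_distr_join_coord:
  "distr lborel borel (\<lambda>(x, t). join_coord x t) = (lborel :: (real^('n::finite option)) measure)"
proof (rule lborel_eqI[symmetric])
  let ?J = "\<lambda>(x, t). join_coord x t :: real^('n::finite option)"
  fix l u :: "real^('n::finite option)"
  assume le: "\<And>b. b \<in> Basis \<Longrightarrow> l \<bullet> b \<le> u \<bullet> b"
  have le_nth: "l $ i \<le> u $ i" for i
    using le[of "axis i 1"] by (simp add: axis_in_Basis_iff inner_axis)
  obtain l1 l2 where l: "l = join_coord l1 l2" by (rule join_coord_cases)
  obtain u1 u2 where u: "u = join_coord u1 u2" by (rule join_coord_cases)
  have le1: "l1 \<bullet> b \<le> u1 \<bullet> b" if "b \<in> Basis" for b
    using that le_nth[of "Some _"] by (auto simp: l u Basis_vec_def inner_axis)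
  have le2: "l2 \<le> u2" using le_nth[of None] by (simp add: l u)
  have [measurable]: "?J \<in> borel_measurable borel"
    by (intro borel_measurable_continuous_onI continuous_on_join_coord)
  have "?J -` box l u = box l1 u1 \<times> box l2 u2"
    by (auto simp: l u mem_box_cart split_option_all)
  then have "emeasure (distr lborel borel ?J) (box l u) =
      emeasure (lborel \<Otimes>\<^sub>M lborel) (box l1 u1 \<times> box l2 u2)"
    by (simp add: emeasure_distr lborel_prod)
  also have "\<dots> = emeasure lborel (box l1 u1) * emeasure lborel (box l2 u2)"
    by (rule lborel.emeasure_pair_measure_Times) auto
  also have "\<dots> = ennreal (\<Prod>i\<in>UNIV. (u1 - l1) $ i) * ennreal (u2 - l2)"
    using le1 le2 by (simp add: emeasure_lborel_box prod_Basis_vec)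
  also have "\<dots> = ennreal (\<Prod>b\<in>Basis. (u - l) \<bullet> b)"
    using le2 unfolding prod_Basis_vec
    by (simp add: l u prod_UNIV_option ennreal_mult'[symmetric] mult.commute)
  finally show "emeasure (distr lborel borel ?J) (box l u) = (\<Prod>b\<in>Basis. (u - l) \<bullet> b)" .
qed simp

lemma lborel_integral_join_coord:
  fixes f :: "real^('n::finite option) \<Rightarrow> real"
  assumes f: "integrable lborel f"
  shows "(LINT z|lborel. f z) = (LINT t|lborel. LINT x|lborel. f (join_coord x t))"
proof -
  let ?J = "\<lambda>(x, t). join_coord x t :: real^('n::finite option)"
  have J: "?J \<in> lborel \<rightarrow>\<^sub>M borel"
    by (simp add: borel_measurable_continuous_onI continuous_on_join_coord)
  have fb: "f \<in> borel_measurable borel" using f by (auto dest: borel_measurable_integrable)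
  have "integrable (distr lborel borel ?J) f"
    using f by (simp only: lborel_distr_join_coord)
  then have "integrable lborel (\<lambda>p. f (?J p))"
    by (rule integrable_distr[OF J])
  then have int: "integrable (lborel \<Otimes>\<^sub>M lborel) (\<lambda>(x, t). f (join_coord x t))"
    by (simp add: lborel_prod case_prod_beta')
  have "(LINT z|lborel. f z) = (LINT z|distr lborel borel ?J. f z)"
    by (simp only: lborel_distr_join_coord)
  also have "\<dots> = (LINT p|lborel. f (?J p))"
    by (rule integral_distr[OF J fb])
  also have "\<dots> = (LINT p|(lborel \<Otimes>\<^sub>M lborel). (\<lambda>(x, t). f (join_coord x t)) p)"
    by (simp add: lborel_prod case_prod_beta')
  also have "\<dots> = (LINT t|lborel. LINT x|lborel. f (join_coord x t))"
    using int by (rule lborel_pair.integral_snd[symmetric])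
  finally show ?thesis .
qed

section \<open>Averaging the divergence over slices\<close>

lemma KL_div_gauss_embed:
  fixes \<Sigma>1 \<Sigma>2 :: "real^'n^'n"
  assumes S: "sym_posdef \<Sigma>1" "sym_posdef \<Sigma>2"
  shows "KL_div (mvn_density 0 (gauss_embed \<mu>1 \<Sigma>1)) (mvn_density 0 (gauss_embed \<mu>2 \<Sigma>2)) =
    KL_div (mvn_density \<mu>1 \<Sigma>1) (mvn_density \<mu>2 \<Sigma>2)"
proof -
  let ?F = "\<lambda>z. mvn_density 0 (gauss_embed \<mu>1 \<Sigma>1) z *
    ln (mvn_density 0 (gauss_embed \<mu>1 \<Sigma>1) z / mvn_density 0 (gauss_embed \<mu>2 \<Sigma>2) z)"
  define K where "K = KL_div (mvn_density 0 \<Sigma>1) (mvn_density 0 \<Sigma>2)"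
  define D where "D = ((\<mu>1 - \<mu>2) \<bullet> (matrix_inv \<Sigma>2 *v (\<mu>1 - \<mu>2))) / 2 * (LINT x|lborel. mvn_density 0 \<Sigma>1 x)"
  have slice: "(LINT x|lborel. ?F (join_coord x t)) =
      K * std_normal_density t + D * (std_normal_density t * t\<^sup>2)" for t
  proof -
    \<comment> \<open>Both embedded densities carry this factor, so it cancels inside the
      logarithm.\<close>
    have "std_normal_density t \<noteq> 0"
      using normal_density_pos[of 1 0 t] by simp
    then have "(LINT x|lborel. ?F (join_coord x t)) = std_normal_density t *
        KL_div (mvn_density (t *\<^sub>R \<mu>1) \<Sigma>1) (mvn_density (t *\<^sub>R \<mu>2) \<Sigma>2)"
      by (simp add: KL_div_def mvn_density_gauss_embed S mult.assoc)
    \<comment> \<open>The difference of the means scales by t, hence its quadratic form by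
      t^2.\<close>
    also have "KL_div (mvn_density (t *\<^sub>R \<mu>1) \<Sigma>1) (mvn_density (t *\<^sub>R \<mu>2) \<Sigma>2) = K + t\<^sup>2 * D"
      unfolding KL_div_mvn_translate[OF S, of "t *\<^sub>R \<mu>1"] K_def D_def scaleR_right_diff_distrib[symmetric]
      by (simp add: matrix_vector_mult_scaleR power2_eq_square)
    finally show ?thesis by (simp add: algebra_simps)
  qed
  have second_moment: "has_bochner_integral lborel (\<lambda>t. std_normal_density t * t\<^sup>2) 1"
    using std_normal_moment_even[of 1] by (simp add: fact_2)
  have "KL_div (mvn_density 0 (gauss_embed \<mu>1 \<Sigma>1)) (mvn_density 0 (gauss_embed \<mu>2 \<Sigma>2)) =
      (LINT t|lborel. LINT x|lborel. ?F (join_coord x t))"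
    unfolding KL_div_def
    by (intro lborel_integral_join_coord integrable_KL_integrand_centered sym_posdef_gauss_embed S)
  also have "\<dots> = (LINT t|lborel. K * std_normal_density t + D * (std_normal_density t * t\<^sup>2))"
    by (simp only: slice)
  also have "\<dots> = K + D"
    using second_moment by (simp add: has_bochner_integral_iff)
  also have "\<dots> = KL_div (mvn_density \<mu>1 \<Sigma>1) (mvn_density \<mu>2 \<Sigma>2)"
    unfolding K_def D_def by (rule KL_div_mvn_translate[OF S, symmetric])
  finally show ?thesis .
qed

theorem proposition3:
  fixes \<mu>1 \<mu>2 :: "real^'d" and \<Sigma>1 \<Sigma>2 :: "real^'d^'d"
  assumes "sym_posdef \<Sigma>1" and "sym_posdef \<Sigma>2"
  shows "sym_posdef (gauss_embed \<mu>1 \<Sigma>1) \<and> sym_posdef (gauss_embed \<mu>2 \<Sigma>2) \<and>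
    KL_div (mvn_density \<mu>1 \<Sigma>1) (mvn_density \<mu>2 \<Sigma>2) =
    KL_div (mvn_density 0 (gauss_embed \<mu>1 \<Sigma>1)) (mvn_density 0 (gauss_embed \<mu>2 \<Sigma>2))"
  using assms by (simp add: sym_posdef_gauss_embed KL_div_gauss_embed)

end
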